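(* Let $(\lambda_2,\ldots,\lambda_n)$ be any list of complex numbers which is closed under complex conjugation such that either all of them are real or all of them are pure imaginary, and let $$w=\min\{\pm\Re(\lambda_2),\pm\Im(\lambda_2),\ldots,\pm\Re(\lambda_n),\pm\Im(\lambda_n)\}.$$ Then there exists a least real number $\lambda_0$ with $$\max_{2\le j\le n}|\lambda_j|\le\lambda_0\le n|w|$$ such that the list of complex numbers $(\lambda_1;\lambda_2,\ldots,\lambda_n)$ is realizable by an $n\times n$ nonnegative generalized doubly stochastic matrix if and only if $\lambda_1\ge\lambda_0$.
   Context: Lists are considered with multiplicity. A real $n\times n$ matrix is generalized doubly stochastic if there is a real number $r\ge 0$ such that every row sum and every column sum equals $r$; it is nonnegative if all its entries are nonnegative. A list $(\lambda_1;\lambda_2,\ldots,\lambda_n)$, with a semicolon after the first entry, is realizable by a nonnegative matrix $A$ if it is the spectrum of $A$ (eigenvalues counted with multiplicity) and $\lambda_1$ is the Perron eigenvalue of $A$ (the nonnegative eigenvalue that is at least the modulus of every other eigenvalue). The notation $\min\{\pm a,\pm b,\ldots\}$ means the minimum of the set containing $a,-a,b,-b,\ldots$. *)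

theory Defs
  imports
    "Jordan_Normal_Form.Char_Poly"
    "HOL-Library.Nonpos_Ints"
begin

definition nonnegative_mat :: "real mat \<Rightarrow> bool" where
  "nonnegative_mat A \<longleftrightarrow> (\<forall>i<dim_row A. \<forall>j<dim_col A. 0 \<le> A $$ (i, j))"

definition generalized_doubly_stochastic :: "real mat \<Rightarrow> bool" where
  "generalized_doubly_stochastic A \<longleftrightarrow> square_mat A \<and>
     (\<exists>r\<ge>0. (\<forall>i<dim_row A. (\<Sum>j<dim_col A. A $$ (i, j)) = r) \<and>
            (\<forall>j<dim_col A. (\<Sum>i<dim_row A. A $$ (i, j)) = r))"

text \<open>Eigenvalues of real matrices are taken over the complex numbers.
  The spectrum is a multiset: eigenvalues are counted with algebraic multiplicity.\<close>

definition spectrum_mset :: "real mat \<Rightarrow> complex multiset" where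
  "spectrum_mset A = proots (char_poly (map_mat complex_of_real A))"

definition is_perron_eigenvalue :: "real mat \<Rightarrow> complex \<Rightarrow> bool" where
  "is_perron_eigenvalue A \<rho> \<longleftrightarrow>
     eigenvalue (map_mat complex_of_real A) \<rho> \<and> \<rho> \<in> \<real>\<^sub>\<ge>\<^sub>0 \<and>
     (\<forall>\<mu>. eigenvalue (map_mat complex_of_real A) \<mu> \<longrightarrow> cmod \<mu> \<le> cmod \<rho>)"

text \<open>The list \<open>(\<lambda>\<^sub>1; \<lambda>\<^sub>2, \<dots>, \<lambda>\<^sub>n)\<close> is represented by the
  head \<open>l1\<close> and the list \<open>ls = [\<lambda>\<^sub>2, \<dots>, \<lambda>\<^sub>n]\<close>.\<close>

definition realizable_by :: "complex \<Rightarrow> complex list \<Rightarrow> real mat \<Rightarrow> bool" where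
  "realizable_by l1 ls A \<longleftrightarrow>
     nonnegative_mat A \<and> spectrum_mset A = mset (l1 # ls) \<and> is_perron_eigenvalue A l1"

text \<open>The first entry ranges over all complex numbers, so \<open>\<lambda>\<^sub>1 \<ge> \<lambda>\<^sub>0\<close> includes
  that \<open>\<lambda>\<^sub>1\<close> is real.\<close>

definition realizability_threshold :: "nat \<Rightarrow> complex list \<Rightarrow> real \<Rightarrow> bool" where
  "realizability_threshold n ls l0 \<longleftrightarrow>
     (\<forall>l1::complex.
        (\<exists>A \<in> carrier_mat n n. generalized_doubly_stochastic A \<and> realizable_by l1 ls A)
        \<longleftrightarrow> l1 \<in> \<real> \<and> l0 \<le> Re l1)"

end

theory Submission
  imports Defs
begin

text \<open>Let \<open>Q\<close> be a symmetric orthogonal matrix with first column \<open>e / \<surd>n\<close>, where \<open>e = (1, \<dots>, 1)\<close>.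
  All line sums of \<open>A\<close> equal \<open>r\<close> iff \<open>Q A Q = [r] \<oplus> A'\<close>, and the Perron eigenvalue
  of a nonnegative such \<open>A\<close> is \<open>r\<close>, so \<open>A'\<close> carries \<open>\<lambda>\<^sub>2, \<dots>, \<lambda>\<^sub>n\<close>. Adding a constant \<open>s \<ge> 0\<close> to every
  entry replaces \<open>r\<close> by \<open>r + n s\<close> and keeps \<open>A'\<close>: the set of attainable \<open>r\<close> is upward
  closed. It is closed by compactness, since the entries lie in \<open>[0, r]\<close> and the characteristic
  polynomial is continuous. It contains \<open>n \<bar>w\<bar>\<close>: a direct sum \<open>B\<close> of real blocks of size 1
  and 2 has the prescribed spectrum and operator norm \<open>max \<bar>\<lambda>\<^sub>j\<bar> \<le> \<bar>w\<bar>\<close>, so the entries of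
  \<open>Q ([0] \<oplus> B) Q\<close> are at least \<open>- \<bar>w\<bar>\<close>, and adding \<open>\<bar>w\<bar>\<close> makes them nonnegative.\<close>

section \<open>Characteristic polynomials of blocks and direct sums\<close>

text \<open>Over the complex numbers the roots are \<open>a + i b\<close> and
  \<open>a - i b\<close>, so for real \<open>a\<close> and \<open>b\<close> this block realizes a
  conjugate pair.\<close>

lemma char_poly_2x2:
  "char_poly (mat 2 2 (\<lambda>(i, j). if i = j then a else if i = 0 then b else - b)) =
     [:a\<^sup>2 + b\<^sup>2, - 2 * a, 1:]" for a b :: "'a :: comm_ring_1"
proof -
  let ?B = "mat 2 2 (\<lambda>(i, j). if i = j then a else if i = 0 then b else - b)"
  have c: "char_poly_matrix ?B \<in> carrier_mat 2 2" by simp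
  have [simp]: "mat_delete (char_poly_matrix ?B) 0 j \<in> carrier_mat 1 1" for j
    by (rule carrier_matI) (auto simp: char_poly_matrix_def)
  have "char_poly ?B = (\<Sum>j<2. char_poly_matrix ?B $$ (0, j) * cofactor (char_poly_matrix ?B) 0 j)"
    unfolding char_poly_def by (rule laplace_expansion_row[OF c]) simp
  also have "\<dots> = [:a\<^sup>2 + b\<^sup>2, - 2 * a, 1:]"
    by (simp add: numeral_2_eq_2 cofactor_def det_single mat_delete_def char_poly_matrix_def
        power2_eq_square algebra_simps)
  finally show ?thesis .
qed

lemma char_poly_1x1: "char_poly (mat 1 1 (\<lambda>_. a)) = [:- a, 1:]"
  unfolding char_poly_def by (subst det_single) (auto simp: char_poly_matrix_def)

lemma char_poly_direct_sum:
  fixes A B :: "'a :: idom mat"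
  assumes "A \<in> carrier_mat k k" "B \<in> carrier_mat m m"
  shows "char_poly (four_block_mat A (0\<^sub>m k m) (0\<^sub>m m k) B) = char_poly A * char_poly B"
proof -
  have "char_poly_matrix (four_block_mat A (0\<^sub>m k m) (0\<^sub>m m k) B) =
      four_block_mat (char_poly_matrix A) (0\<^sub>m k m) (0\<^sub>m m k) (char_poly_matrix B)"
    using assms by (intro eq_matI) (auto simp: char_poly_matrix_def)
  then show ?thesis
    unfolding char_poly_def using assms
    by (simp add: det_four_block_mat_upper_right_zero[where n = k and m = m])
qed

section \<open>Operator norm bounds\<close>

text \<open>The Euclidean operator norm is at most \<open>\<bar>M\<bar>\<close>; squaring avoids
  square roots.\<close>

definition norm_bounded :: "real \<Rightarrow> real mat \<Rightarrow> bool" where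
  "norm_bounded M B \<longleftrightarrow> (\<forall>y\<in>carrier_vec (dim_col B). (B *\<^sub>v y) \<bullet> (B *\<^sub>v y) \<le> M\<^sup>2 * (y \<bullet> y))"

text \<open>Each block acts on its own part of \<open>y = u @\<^sub>v v\<close>, and squared lengths
  of the two parts add up.\<close>

lemma norm_bounded_direct_sum:
  assumes A: "A \<in> carrier_mat k k" and B: "B \<in> carrier_mat m m"
    and "norm_bounded M A" "norm_bounded M B"
  shows "norm_bounded M (four_block_mat A (0\<^sub>m k m) (0\<^sub>m m k) B)" (is "norm_bounded M ?C")
  unfolding norm_bounded_def
proof
  fix y :: "real vec" assume "y \<in> carrier_vec (dim_col ?C)"
  then have y: "y \<in> carrier_vec (k + m)" using A B by simp
  define u v where "u = vec_first y k" and "v = vec_last y m"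
  have u: "u \<in> carrier_vec k" and v: "v \<in> carrier_vec m" and uv: "y = u @\<^sub>v v"
    using y by (auto simp: u_def v_def)
  have "?C *\<^sub>v y = (A *\<^sub>v u) @\<^sub>v (B *\<^sub>v v)"
  proof (rule eq_vecI)
    fix i assume "i < dim_vec ((A *\<^sub>v u) @\<^sub>v (B *\<^sub>v v))"
    then have i: "i < k + m" using A B by simp
    show "(?C *\<^sub>v y) $ i = ((A *\<^sub>v u) @\<^sub>v (B *\<^sub>v v)) $ i"
    proof (cases "i < k")
      case True
      then have "row ?C i = row A i @\<^sub>v 0\<^sub>v m"
        using A B by (intro eq_vecI) auto
      moreover have "row A i \<in> carrier_vec k" using A True by simp
      ultimately show ?thesis using True i A B u v
        by (simp add: uv scalar_prod_append[of _ k _ m])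
    next
      case False
      then have "row ?C i = 0\<^sub>v k @\<^sub>v row B (i - k)"
        using A B i by (intro eq_vecI) auto
      moreover have "row B (i - k) \<in> carrier_vec m" using B by (intro carrier_vecI) simp
      ultimately show ?thesis using False i A B u v
        by (simp add: uv scalar_prod_append[of _ k _ m])
    qed
  qed (use A B in simp)
  then have "(?C *\<^sub>v y) \<bullet> (?C *\<^sub>v y) = (A *\<^sub>v u) \<bullet> (A *\<^sub>v u) + (B *\<^sub>v v) \<bullet> (B *\<^sub>v v)"
    using A B u v by (simp add: scalar_prod_append[of _ k _ m])
  also have "\<dots> \<le> M\<^sup>2 * (u \<bullet> u) + M\<^sup>2 * (v \<bullet> v)"
    using assms u v by (intro add_mono) (auto simp: norm_bounded_def)
  also have "\<dots> = M\<^sup>2 * (y \<bullet> y)"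
    using u v by (simp add: uv scalar_prod_append[of _ k _ m] algebra_simps)
  finally show "(?C *\<^sub>v y) \<bullet> (?C *\<^sub>v y) \<le> M\<^sup>2 * (y \<bullet> y)" .
qed

lemma norm_bounded_1x1:
  assumes "\<bar>a\<bar> \<le> M"
  shows "norm_bounded M (mat 1 1 (\<lambda>_. a))"
proof -
  have "a\<^sup>2 \<le> M\<^sup>2" using assms by (metis abs_ge_zero power2_abs power_mono)
  then have "a\<^sup>2 * (y $ 0)\<^sup>2 \<le> M\<^sup>2 * (y $ 0)\<^sup>2" for y :: "real vec"
    by (intro mult_right_mono) auto
  then show ?thesis
    by (simp add: norm_bounded_def scalar_prod_def power2_eq_square mult_ac)
qed

text \<open>The block is a rotation scaled by the square root of
  \<open>a\<^sup>2 + b\<^sup>2\<close>, so it multiplies every squared length by exactly that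
  number.\<close>

lemma norm_bounded_2x2:
  assumes "a\<^sup>2 + b\<^sup>2 \<le> M\<^sup>2"
  shows "norm_bounded M (mat 2 2 (\<lambda>(i, j). if i = j then a else if i = 0 then b else - b))"
proof -
  have *: "(a * s + b * t)\<^sup>2 + (- b * s + a * t)\<^sup>2 \<le> M\<^sup>2 * (s\<^sup>2 + t\<^sup>2)" for s t
  proof -
    have "(a * s + b * t)\<^sup>2 + (- b * s + a * t)\<^sup>2 = (a\<^sup>2 + b\<^sup>2) * (s\<^sup>2 + t\<^sup>2)"
      by (simp add: power2_eq_square algebra_simps)
    also have "\<dots> \<le> M\<^sup>2 * (s\<^sup>2 + t\<^sup>2)" using assms by (intro mult_right_mono) auto
    finally show ?thesis .
  qed
  show ?thesis
    unfolding norm_bounded_def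
  proof
    fix y :: "real vec" assume "y \<in> carrier_vec (dim_col (mat 2 2 (\<lambda>(i, j). if i = j then a else if i = 0 then b else - b)))"
    then have "dim_vec y = 2" by simp
    then show "(mat 2 2 (\<lambda>(i, j). if i = j then a else if i = 0 then b else - b) *\<^sub>v y) \<bullet>
      (mat 2 2 (\<lambda>(i, j). if i = j then a else if i = 0 then b else - b) *\<^sub>v y) \<le> M\<^sup>2 * (y \<bullet> y)"
      using *[of "y $ 0" "y $ 1"]
      by (simp add: scalar_prod_def numeral_2_eq_2 power2_eq_square)
  qed
qed

text \<open>Cauchy-Schwarz for the unit vector \<open>x\<close> and
  \<open>v = B *\<^sub>v y\<close>: subtracting from \<open>v\<close> its projection
  \<open>t x\<close> leaves squared length \<open>v \<bullet> v - t\<^sup>2\<close>, which is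
  nonnegative.\<close>

lemma norm_bounded_bilinear:
  assumes B: "B \<in> carrier_mat n n" "norm_bounded M B" and "0 \<le> M"
    and x: "x \<in> carrier_vec n" "x \<bullet> x = 1" and y: "y \<in> carrier_vec n" "y \<bullet> y = 1"
  shows "\<bar>x \<bullet> (B *\<^sub>v y)\<bar> \<le> M"
proof -
  define v where "v = B *\<^sub>v y"
  define t where "t = x \<bullet> v"
  have v: "v \<in> carrier_vec n" using B y by (simp add: v_def)
  have "0 \<le> (\<Sum>i<n. (v $ i - t * x $ i)\<^sup>2)" by (intro sum_nonneg) simp
  also have "\<dots> = (\<Sum>i<n. v $ i * v $ i - (2 * t) * (x $ i * v $ i) + t\<^sup>2 * (x $ i * x $ i))"
    by (intro sum.cong) (auto simp: power2_eq_square algebra_simps)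
  also have "\<dots> = v \<bullet> v - (2 * t) * t + t\<^sup>2 * (x \<bullet> x)"
    using x(1) v unfolding t_def
    by (simp add: sum.distrib sum_subtractf sum_distrib_left[symmetric] scalar_prod_def lessThan_atLeast0)
  also have "\<dots> = v \<bullet> v - t\<^sup>2" using x(2) by (simp add: power2_eq_square)
  finally have "t\<^sup>2 \<le> v \<bullet> v" by simp
  also have "\<dots> \<le> M\<^sup>2"
    using B y by (auto simp: norm_bounded_def v_def)
  finally show ?thesis using \<open>0 \<le> M\<close> by (simp add: abs_le_square_iff[symmetric] t_def v_def)
qed

section \<open>A real matrix with prescribed spectrum and small norm\<close>

lemma map_poly_of_real_mult:
  "map_poly complex_of_real (p * q) = map_poly of_real p * map_poly of_real q"
proof -
  interpret map_poly_comm_ring_hom complex_of_real ..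
  show ?thesis by (rule hom_mult)
qed

text \<open>Split off a block of size 1 for a real \<open>z\<close>, or of size 2 for a nonreal
  \<open>z\<close> together with \<open>cnj z\<close>. Either way the rest of \<open>L\<close> is
  still closed under conjugation, so the induction goes on.\<close>

lemma real_matrix_with_spectrum:
  assumes "image_mset cnj L = L" "\<forall>z\<in>#L. cmod z \<le> M"
  shows "\<exists>B \<in> carrier_mat (size L) (size L).
           proots (map_poly complex_of_real (char_poly B)) = L \<and> norm_bounded M B"
  using assms
proof (induction "size L" arbitrary: L rule: less_induct)
  case less
  \<comment> \<open>The roots of a product are the union of the roots only for nonzero factors;
    characteristic polynomials are monic.\<close>
  have nz: "map_poly complex_of_real (char_poly B) \<noteq> 0" if "B \<in> carrier_mat k k" for B k
    using degree_monic_char_poly[OF that] by auto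
  consider "L = {#}" | z where "z \<in># L" "z \<in> \<real>" | z where "z \<in># L" "z \<notin> \<real>"
    by (metis multiset_nonemptyE)
  then show ?case
  proof cases
    case 1
    have "char_poly (0\<^sub>m 0 0 :: real mat) = 1"
      by (simp add: char_poly_def char_poly_matrix_def)
    then show ?thesis
      using 1 by (intro bexI[of _ "0\<^sub>m 0 0"]) (auto simp: norm_bounded_def scalar_prod_def)
  next
    case (2 z)
    then obtain L' where L: "L = add_mset z L'" by (meson multi_member_split)
    have cz: "cnj z = z" using 2 by (simp add: Reals_cnj_iff)
    obtain B where B: "B \<in> carrier_mat (size L') (size L')"
      "proots (map_poly complex_of_real (char_poly B)) = L'" "norm_bounded M B"
      using less.hyps[of L'] less.prems cz by (auto simp: L)
    define C where "C = mat 1 1 (\<lambda>_. Re z)"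
    have C: "C \<in> carrier_mat 1 1" by (simp add: C_def)
    have "char_poly C = [:- Re z, 1:]"
      unfolding C_def by (rule char_poly_1x1)
    then have "map_poly complex_of_real (char_poly C) = [:- z, 1:]"
      using 2 by (simp add: map_poly_pCons)
    moreover have "norm_bounded M C"
      unfolding C_def using less.prems abs_Re_le_cmod[of z]
      by (intro norm_bounded_1x1) (force simp: L)
    ultimately show ?thesis
      using B C nz[OF B(1)] char_poly_direct_sum[OF C B(1)] norm_bounded_direct_sum[OF C B(1)]
      by (intro bexI[of _ "four_block_mat C (0\<^sub>m 1 (size L')) (0\<^sub>m (size L') 1) B"])
        (auto simp: L map_poly_of_real_mult proots_mult intro!: four_block_carrier_mat
          simp del: mult_pCons_left mult_pCons_right)
  next
    case (3 z)
    then obtain L1 where L1: "L = add_mset z L1" by (meson multi_member_split)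
    have cz: "cnj z \<noteq> z" using 3 by (simp add: Reals_cnj_iff)
    have "cnj z \<in># L" using less.prems(1) 3(1) by (metis image_eqI set_image_mset)
    then have "cnj z \<in># L1" using cz L1 by auto
    then obtain L' where L': "L1 = add_mset (cnj z) L'" by (meson multi_member_split)
    note L = L1[unfolded L']
    obtain B where B: "B \<in> carrier_mat (size L') (size L')"
      "proots (map_poly complex_of_real (char_poly B)) = L'" "norm_bounded M B"
      using less.hyps[of L'] less.prems by (auto simp: L add_mset_commute)
    define C where
      "C = mat 2 2 (\<lambda>(i, j). if i = j then Re z else if i = 0 then Im z else - Im z)"
    have C: "C \<in> carrier_mat 2 2" by (simp add: C_def)
    have "map_poly complex_of_real (char_poly C) = [:- z, 1:] * [:- cnj z, 1:]"
      unfolding C_def char_poly_2x2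
      by (simp add: map_poly_pCons complex_eq_iff power2_eq_square)
    then have "proots (map_poly complex_of_real (char_poly C)) = {#z, cnj z#}"
      by (simp add: proots_mult del: mult_pCons_left mult_pCons_right)
    moreover have "norm_bounded M C"
      unfolding C_def
    proof (intro norm_bounded_2x2)
      have "cmod z ^ 2 \<le> M ^ 2" using less.prems 3 by (intro power_mono) auto
      then show "(Re z)\<^sup>2 + (Im z)\<^sup>2 \<le> M\<^sup>2" by (simp add: cmod_power2)
    qed
    ultimately show ?thesis
      using B C nz[OF B(1)] nz[OF C] char_poly_direct_sum[OF C B(1)] norm_bounded_direct_sum[OF C B(1)]
      by (intro bexI[of _ "four_block_mat C (0\<^sub>m 2 (size L')) (0\<^sub>m (size L') 2) B"])
        (auto simp: L map_poly_of_real_mult proots_mult intro!: four_block_carrier_mat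
          simp del: mult_pCons_left mult_pCons_right)
  qed
qed

section \<open>A symmetric orthogonal matrix with constant first column\<close>

lemma sum_delta_mult: "(\<Sum>k<n. (if i = k then 1 else 0) * f k) = (if i < n then f i else (0::real))"
  for i n :: nat
  by (simp add: if_distrib[of "\<lambda>c. c * _"] cong: if_cong)

lemma ex_orthogonal_symmetric_first_column:
  assumes "n \<ge> 1"
  shows "\<exists>Q \<in> carrier_mat n n. transpose_mat Q = Q \<and> Q * Q = 1\<^sub>m n \<and> (\<forall>i<n. Q $$ (i, 0) = 1 / sqrt (real n))"
proof -
  \<comment> \<open>Householder reflection swapping \<open>e\<^sub>0\<close> and \<open>(1, \<dots>, 1) / \<surd>n\<close>; for \<open>n = 1\<close> it degenerates
     to the identity because \<open>u = 0\<close> and \<open>c = 2 / 0 = 0\<close>.\<close>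
  define u where "u i = (if i = 0 then 1 else 0) - 1 / sqrt (real n)" for i :: nat
  define S where "S = (\<Sum>k<n. u k * u k)"
  define c where "c = 2 / S"
  define Q where "Q = mat n n (\<lambda>(i, j). (if i = j then 1 else 0) - c * u i * u j)"
  have Q: "Q \<in> carrier_mat n n" by (simp add: Q_def)
  \<comment> \<open>\<open>u\<close> is the difference of two unit vectors with inner product
    \<open>1 / sqrt n\<close>.\<close>
  have S: "S = 2 - 2 / sqrt n"
  proof -
    have "S = (\<Sum>k<n. (if 0 = k then 1 else 0) * (1 - 2 / sqrt n) + 1 / n)"
      unfolding S_def u_def by (intro sum.cong) (auto simp: algebra_simps)
    also have "\<dots> = (1 - 2 / sqrt n) + 1"
      using assms unfolding sum.distrib sum_delta_mult by simp
    finally show ?thesis by simp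
  qed
  \<comment> \<open>The extra factor \<open>c\<close> keeps the equation true when
    \<open>S = 0\<close>, where \<open>c = 0\<close>; so \<open>Q * Q = 1\<^sub>m n\<close> needs no
    case split.\<close>
  have cS: "c * (c * S) = 2 * c" by (simp add: c_def)
  have "(Q * Q) $$ (i, j) = 1\<^sub>m n $$ (i, j)" if ij: "i < n" "j < n" for i j
  proof -
    have "(Q * Q) $$ (i, j) = (\<Sum>k<n. Q $$ (i, k) * Q $$ (k, j))"
      using ij Q by (auto simp: scalar_prod_def lessThan_atLeast0)
    also have "\<dots> = (\<Sum>k<n. (if i = k then 1 else 0) * ((if k = j then 1 else 0) - c * u k * u j)
        - (if j = k then 1 else 0) * (c * u i * u k) + c * c * u i * u j * (u k * u k))"
      using ij by (intro sum.cong) (auto simp: Q_def algebra_simps)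
    also have "\<dots> = ((if i = j then 1 else 0) - c * u i * u j) - c * u i * u j + c * c * u i * u j * S"
      unfolding S_def sum.distrib sum_subtractf sum_delta_mult sum_distrib_left using ij by simp
    also have "\<dots> = (if i = j then 1 else 0) + (c * (c * S) - 2 * c) * u i * u j"
      by (simp add: algebra_simps)
    finally show ?thesis using ij cS by simp
  qed
  then have "Q * Q = 1\<^sub>m n" using Q by (intro eq_matI) auto
  moreover have "transpose_mat Q = Q" by (intro eq_matI) (auto simp: Q_def)
  moreover have "Q $$ (i, 0) = 1 / sqrt n" if "i < n" for i
  proof (cases "n = 1")
    case True
    then show ?thesis using that by (simp add: Q_def u_def)
  next
    case False
    then have "sqrt n > 1" using assms by simp
    \<comment> \<open>\<open>u 0 = 1 - 1 / sqrt n\<close> is half of \<open>S\<close>, and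
      \<open>S\<close> is nonzero because \<open>n > 1\<close>.\<close>
    then have "c * u 0 = 1" unfolding c_def u_def S by (simp add: field_simps)
    then have "c * u i * u 0 = u i" by (metis mult.assoc mult.commute mult.left_neutral)
    moreover have "Q $$ (i, 0) = (if i = 0 then 1 else 0) - c * u i * u 0"
      using that assms by (simp add: Q_def)
    ultimately have "Q $$ (i, 0) = (if i = 0 then 1 else 0) - u i" by simp
    then show ?thesis by (simp add: u_def)
  qed
  ultimately show ?thesis using Q by blast
qed

section \<open>Line sums and conjugation by \<open>Q\<close>\<close>

definition line_sums :: "real mat \<Rightarrow> real \<Rightarrow> bool" where
  "line_sums A r \<longleftrightarrow> (\<forall>i<dim_row A. (\<Sum>j<dim_col A. A $$ (i, j)) = r) \<and>
     (\<forall>j<dim_col A. (\<Sum>i<dim_row A. A $$ (i, j)) = r)"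

lemma line_sums_transpose: "line_sums (transpose_mat A) r \<longleftrightarrow> line_sums A r"
  by (auto simp: line_sums_def)

text \<open>The size \<open>Suc m\<close> leaves a block of size \<open>m\<close>, the length of the
  list \<open>ls\<close>, once the direction of the all-ones vector is split off.\<close>

locale reflection =
  fixes m :: nat and Q :: "real mat"
  assumes Q: "Q \<in> carrier_mat (Suc m) (Suc m)" "transpose_mat Q = Q" "Q * Q = 1\<^sub>m (Suc m)"
    and Q0: "\<And>i. i < Suc m \<Longrightarrow> Q $$ (i, 0) = 1 / sqrt (real (Suc m))"
begin

lemma Q_sym: "i < Suc m \<Longrightarrow> j < Suc m \<Longrightarrow> Q $$ (i, j) = Q $$ (j, i)"
  using Q(1) arg_cong[OF Q(2), of "\<lambda>A. A $$ (i, j)"] by simp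

lemma Q_orth: "i < Suc m \<Longrightarrow> j < Suc m \<Longrightarrow>
    (\<Sum>k<Suc m. Q $$ (i, k) * Q $$ (k, j)) = (if i = j then 1 else 0)"
  using Q(1) arg_cong[OF Q(3), of "\<lambda>A. A $$ (i, j)"]
  by (simp add: scalar_prod_def lessThan_atLeast0 del: sum.lessThan_Suc sum.op_ivl_Suc)

text \<open>Column 0 of \<open>Q\<close> is constant, so a row sum is \<open>sqrt (Suc m)\<close>
  times an entry in column 0 of \<open>Q * Q\<close>, the identity.\<close>

lemma Q_row_sum:
  assumes "i < Suc m"
  shows "(\<Sum>k<Suc m. Q $$ (i, k)) = (if i = 0 then sqrt (Suc m) else 0)"
proof -
  have "(\<Sum>k<Suc m. Q $$ (i, k) * Q $$ (k, 0)) = (\<Sum>k<Suc m. Q $$ (i, k)) * (1 / sqrt (Suc m))"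
    unfolding sum_distrib_right using Q0 by (intro sum.cong) auto
  then show ?thesis using Q_orth[OF assms, of 0] by (simp add: field_simps split: if_splits del: sum.lessThan_Suc)
qed

lemma char_poly_conj:
  assumes A: "A \<in> carrier_mat (Suc m) (Suc m)"
  shows "char_poly (Q * A * Q) = char_poly A"
  by (intro char_poly_similar similar_matI[of _ _ Q Q "Suc m"]) (use Q A in auto)

lemma conj_entry:
  assumes A: "A \<in> carrier_mat (Suc m) (Suc m)" and ij: "i < Suc m" "j < Suc m"
  shows "(Q * A * Q) $$ (i, j) = (\<Sum>k<Suc m. Q $$ (i, k) * (\<Sum>l<Suc m. A $$ (k, l) * Q $$ (l, j)))"
proof -
  have "Q * A * Q = Q * (A * Q)" using A Q(1) by simp
  then show ?thesis using A Q(1) ij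
    by (simp add: scalar_prod_def lessThan_atLeast0 del: sum.lessThan_Suc sum.op_ivl_Suc)
qed

text \<open>Column 0 of \<open>Q\<close> is a multiple of the all-ones vector, hence an eigenvector
  of \<open>A\<close> for \<open>r\<close>; the outer factor \<open>Q\<close> maps it back to the
  first basis vector.\<close>

lemma conj_first_col:
  assumes A: "A \<in> carrier_mat (Suc m) (Suc m)" and r: "line_sums A r" and i: "i < Suc m"
  shows "(Q * A * Q) $$ (i, 0) = (if i = 0 then r else 0)"
proof -
  have *: "(\<Sum>l<Suc m. A $$ (k, l) * Q $$ (l, 0)) = r / sqrt (Suc m)" if "k < Suc m" for k
  proof -
    have "(\<Sum>l<Suc m. A $$ (k, l) * Q $$ (l, 0)) = (\<Sum>l<Suc m. A $$ (k, l)) * (1 / sqrt (Suc m))"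
      unfolding sum_distrib_right using Q0 by (intro sum.cong) auto
    then show ?thesis using r that A by (simp add: line_sums_def del: sum.lessThan_Suc)
  qed
  have "(Q * A * Q) $$ (i, 0) = (\<Sum>k<Suc m. Q $$ (i, k) * (r / sqrt (Suc m)))"
    using A i by (subst conj_entry) (auto intro!: sum.cong simp: * simp del: sum.lessThan_Suc)
  also have "\<dots> = (\<Sum>k<Suc m. Q $$ (i, k)) * (r / sqrt (Suc m))" by (simp only: sum_distrib_right)
  finally show ?thesis using Q_row_sum[OF i] by (simp del: sum.lessThan_Suc)
qed

lemma conj_first_row:
  assumes A: "A \<in> carrier_mat (Suc m) (Suc m)" and r: "line_sums A r" and i: "i < Suc m"
  shows "(Q * A * Q) $$ (0, i) = (if i = 0 then r else 0)"
proof -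
  have "transpose_mat (Q * A * Q) = Q * transpose_mat A * Q"
    using A Q(1,2) by (simp add: transpose_mult[of _ "Suc m" "Suc m" _ "Suc m"])
  then have "(Q * A * Q) $$ (0, i) = (Q * transpose_mat A * Q) $$ (i, 0)"
    using A Q(1) i by (metis Zero_not_Suc bot_nat_0.not_eq_extremum carrier_matD index_mult_mat(2,3)
        index_transpose_mat(1) not_less_eq)
  then show ?thesis using conj_first_col[of "transpose_mat A"] A r i by (simp add: line_sums_transpose)
qed

text \<open>Deflation: row 0 and column 0 of \<open>Q * A * Q\<close> vanish off the diagonal, so
  the conjugate is the direct sum of \<open>r\<close> and the remaining block.\<close>

lemma char_poly_line_sums:
  assumes A: "A \<in> carrier_mat (Suc m) (Suc m)" and r: "line_sums A r"
  shows "char_poly A = [:- r, 1:] * char_poly (mat m m (\<lambda>(i, j). (Q * A * Q) $$ (Suc i, Suc j)))"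
    (is "_ = _ * char_poly ?B")
proof -
  have "Q * A * Q = four_block_mat (mat 1 1 (\<lambda>_. r)) (0\<^sub>m 1 m) (0\<^sub>m m 1) ?B"
    using A Q(1) conj_first_col[OF A r] conj_first_row[OF A r]
    by (intro eq_matI) (auto simp del: index_mult_mat(1) simp: less_Suc_eq_0_disj)
  then have "char_poly A = char_poly (mat 1 1 (\<lambda>_. r)) * char_poly ?B"
    using char_poly_conj[OF A] char_poly_direct_sum[of "mat 1 1 (\<lambda>_. r)" 1 ?B m] by simp
  also have "char_poly (mat 1 1 (\<lambda>_. r)) = [:- r, 1:]"
    by (rule char_poly_1x1)
  finally show ?thesis .
qed

text \<open>\<open>Q\<close> maps the all-ones vector to a multiple of the first basis vector, which
  \<open>C\<close> and its transpose both send to 0.\<close>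

lemma line_sums_conj:
  assumes C: "C \<in> carrier_mat (Suc m) (Suc m)"
    and c0: "\<And>i. i < Suc m \<Longrightarrow> C $$ (i, 0) = 0" "\<And>i. i < Suc m \<Longrightarrow> C $$ (0, i) = 0"
  shows "line_sums (Q * C * Q) 0"
proof -
  have r: "(\<Sum>j<Suc m. (Q * D * Q) $$ (i, j)) = 0"
    if D: "D \<in> carrier_mat (Suc m) (Suc m)" and d0: "\<And>i. i < Suc m \<Longrightarrow> D $$ (i, 0) = 0"
    and i: "i < Suc m" for D i
  proof -
    have "(\<Sum>j<Suc m. (Q * D * Q) $$ (i, j)) =
       (\<Sum>j<Suc m. \<Sum>k<Suc m. \<Sum>l<Suc m. Q $$ (i, k) * (D $$ (k, l) * Q $$ (l, j)))"
      using i by (intro sum.cong) (auto simp: conj_entry[OF D] sum_distrib_left simp del: sum.lessThan_Suc)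
    \<comment> \<open>With \<open>j\<close> innermost, \<open>Q_row_sum\<close> leaves only
      \<open>l = 0\<close>, where \<open>D\<close> vanishes.\<close>
    also have "\<dots> = (\<Sum>k<Suc m. \<Sum>l<Suc m. \<Sum>j<Suc m. Q $$ (i, k) * (D $$ (k, l) * Q $$ (l, j)))"
      by (subst sum.swap) (intro sum.cong refl sum.swap)
    also have "\<dots> = (\<Sum>k<Suc m. \<Sum>l<Suc m. Q $$ (i, k) * D $$ (k, l) * (\<Sum>j<Suc m. Q $$ (l, j)))"
      by (simp only: sum_distrib_left mult.assoc)
    also have "\<dots> = 0"
      by (intro sum.neutral ballI) (auto simp: Q_row_sum d0 simp del: sum.lessThan_Suc)
    finally show ?thesis .
  qed
  have "transpose_mat (Q * C * Q) = Q * transpose_mat C * Q"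
    using C Q(1,2) by (simp add: transpose_mult[of _ "Suc m" "Suc m" _ "Suc m"])
  then have "(Q * C * Q) $$ (i, j) = (Q * transpose_mat C * Q) $$ (j, i)" if "i < Suc m" "j < Suc m" for i j
    using C Q(1) that by (metis carrier_matD index_mult_mat(2,3) index_transpose_mat(1))
  then have "(\<Sum>i<Suc m. (Q * C * Q) $$ (i, j)) = 0" if "j < Suc m" for j
    using r[of "transpose_mat C" j] C c0(2) that by (simp del: sum.lessThan_Suc index_mult_mat(1))
  then show ?thesis
    using r[OF C c0(1)] Q(1) C by (simp add: line_sums_def del: sum.lessThan_Suc index_mult_mat(1))
qed

text \<open>The columns of \<open>Q\<close> other than column 0 are orthogonal to the all-ones
  vector, so the added constant matrix does not affect those columns of \<open>Q * A * Q\<close>,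
  and the deflated block stays the same.\<close>

lemma char_poly_shift:
  fixes s :: real
  assumes A: "A \<in> carrier_mat (Suc m) (Suc m)" and r: "line_sums A r"
    and cp: "char_poly A = [:- r, 1:] * P"
  defines "A' \<equiv> mat (Suc m) (Suc m) (\<lambda>(i, j). A $$ (i, j) + s)"
  shows "line_sums A' (r + real (Suc m) * s)"
    and "char_poly A' = [:- (r + real (Suc m) * s), 1:] * P"
proof -
  have A': "A' \<in> carrier_mat (Suc m) (Suc m)" by (simp add: A'_def)
  show ls: "line_sums A' (r + real (Suc m) * s)"
    using r A by (simp add: A'_def line_sums_def sum.distrib del: sum.lessThan_Suc of_nat_Suc)
  have "(Q * A' * Q) $$ (i, j) = (Q * A * Q) $$ (i, j)" if ij: "i < Suc m" "j < Suc m" "j \<noteq> 0" for i j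
  proof -
    have "(\<Sum>l<Suc m. Q $$ (l, j)) = (\<Sum>l<Suc m. Q $$ (j, l))"
      using ij by (intro sum.cong) (auto simp: Q_sym)
    then have "(\<Sum>l<Suc m. s * Q $$ (l, j)) = 0"
      using Q_row_sum[of j] ij by (simp only: sum_distrib_left[symmetric]) simp
    then have "(\<Sum>l<Suc m. A' $$ (k, l) * Q $$ (l, j)) = (\<Sum>l<Suc m. A $$ (k, l) * Q $$ (l, j))"
      if "k < Suc m" for k
      using that by (simp add: A'_def algebra_simps sum.distrib del: sum.lessThan_Suc)
    then show ?thesis
      using ij by (simp add: conj_entry[OF A'] conj_entry[OF A] del: sum.lessThan_Suc index_mult_mat(1))
  qed
  then have eq: "mat m m (\<lambda>(i, j). (Q * A' * Q) $$ (Suc i, Suc j)) =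
      mat m m (\<lambda>(i, j). (Q * A * Q) $$ (Suc i, Suc j))"
    by (intro eq_matI) (auto simp del: index_mult_mat(1))
  \<comment> \<open>Cancelling the nonzero linear factor identifies \<open>P\<close> with the
    characteristic polynomial of the deflated block.\<close>
  have "P = char_poly (mat m m (\<lambda>(i, j). (Q * A * Q) $$ (Suc i, Suc j)))"
    using char_poly_line_sums[OF A r] unfolding cp
    by (metis mult_cancel_left pCons_eq_0_iff zero_neq_one)
  then show "char_poly A' = [:- (r + real (Suc m) * s), 1:] * P"
    using char_poly_line_sums[OF A' ls] eq by simp
qed

text \<open>Conjugate the direct sum of 0 and \<open>B\<close>. Each entry of the result is a
  bilinear form of that direct sum at two columns of \<open>Q\<close>, which are unit
  vectors.\<close>

lemma zero_line_sums_matrix: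
  assumes B: "B \<in> carrier_mat m m" "norm_bounded M B" and M: "0 \<le> M"
  shows "\<exists>A \<in> carrier_mat (Suc m) (Suc m). line_sums A 0 \<and> char_poly A = [:0, 1:] * char_poly B \<and>
     (\<forall>i<Suc m. \<forall>j<Suc m. \<bar>A $$ (i, j)\<bar> \<le> M)"
proof -
  define C where "C = four_block_mat (mat 1 1 (\<lambda>_. 0)) (0\<^sub>m 1 m) (0\<^sub>m m 1) B"
  have C: "C \<in> carrier_mat (Suc m) (Suc m)"
    unfolding C_def using four_block_carrier_mat[of "mat 1 1 (\<lambda>_. 0)" 1 1 B m m] B by simp
  have nb: "norm_bounded M C"
    unfolding C_def using B M by (intro norm_bounded_direct_sum norm_bounded_1x1) auto
  have "char_poly C = char_poly (mat 1 1 (\<lambda>_. 0)) * char_poly B"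
    unfolding C_def using B by (intro char_poly_direct_sum) auto
  also have "char_poly (mat 1 1 (\<lambda>_. 0)) = ([:0, 1:] :: real poly)"
    by (simp only: char_poly_1x1) simp
  finally have "char_poly (Q * C * Q) = [:0, 1:] * char_poly B" using char_poly_conj[OF C] by simp
  moreover have "line_sums (Q * C * Q) 0"
    using B by (intro line_sums_conj[OF C]) (auto simp: C_def)
  moreover have "\<bar>(Q * C * Q) $$ (i, j)\<bar> \<le> M" if ij: "i < Suc m" "j < Suc m" for i j
  proof -
    have unit: "col Q k \<bullet> col Q k = 1" if "k < Suc m" for k
    proof -
      have "col Q k \<bullet> col Q k = (\<Sum>l<Suc m. Q $$ (k, l) * Q $$ (l, k))"
        using Q(1) that unfolding scalar_prod_def lessThan_atLeast0
        by (intro sum.cong) (auto simp: Q_sym)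
      then show ?thesis using Q_orth[OF that that] by simp
    qed
    have "Q * C * Q = Q * (C * Q)" using C Q(1) by simp
    moreover have "row Q i = col Q i" using Q ij by (metis carrier_matD(1) row_transpose carrier_matD(2))
    moreover have "col (C * Q) j = C *\<^sub>v col Q j"
      by (rule col_mult2[OF C Q(1) ij(2)])
    ultimately have "(Q * C * Q) $$ (i, j) = col Q i \<bullet> (C *\<^sub>v col Q j)"
      using C Q(1) ij by (metis carrier_matD index_mult_mat(1-3))
    then show ?thesis
      using norm_bounded_bilinear[OF C nb M _ unit[OF ij(1)] _ unit[OF ij(2)]] Q(1) ij by simp
  qed
  ultimately show ?thesis using C Q(1) by (intro bexI[of _ "Q * C * Q"]) auto
qed

end

section \<open>Compactness and limits of matrices\<close>

text \<open>Bolzano-Weierstrass one index at a time: a bounded sequence has a monotone, hence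
  convergent, subsequence, and thinning out keeps the earlier limits.\<close>

lemma finite_family_convergent_subseq:
  fixes a :: "nat \<Rightarrow> 'i \<Rightarrow> real"
  assumes "finite I" "\<And>k i. i \<in> I \<Longrightarrow> \<bar>a k i\<bar> \<le> K"
  shows "\<exists>\<phi>. strict_mono \<phi> \<and> (\<forall>i\<in>I. convergent (\<lambda>k. a (\<phi> k) i))"
  using assms
proof (induction I rule: finite_induct)
  case empty
  then show ?case using strict_mono_id by blast
next
  case (insert x I)
  then obtain \<phi> where \<phi>: "strict_mono \<phi>" "\<forall>i\<in>I. convergent (\<lambda>k. a (\<phi> k) i)" by auto
  obtain \<psi> where \<psi>: "strict_mono \<psi>" "monoseq (\<lambda>k. a (\<phi> (\<psi> k)) x)"
    using seq_monosub[of "\<lambda>k. a (\<phi> k) x"] by blast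
  have "Bseq (\<lambda>k. a (\<phi> (\<psi> k)) x)" using insert.prems by (intro BseqI'[of _ K]) simp
  then have "convergent (\<lambda>k. a (\<phi> (\<psi> k)) x)" using \<psi>(2) by (rule Bseq_monoseq_convergent)
  moreover have "convergent (\<lambda>k. a (\<phi> (\<psi> k)) i)" if "i \<in> I" for i
    using convergent_subseq_convergent[of "\<lambda>k. a (\<phi> k) i" \<psi>] \<phi>(2) \<psi>(1) that by (simp add: o_def)
  ultimately show ?case
    using strict_mono_o[OF \<phi>(1) \<psi>(1)] by (intro exI[of _ "\<phi> \<circ> \<psi>"]) (simp add: o_def)
qed

lemma tendsto_det:
  fixes A :: "nat \<Rightarrow> real mat"
  assumes "\<And>k. A k \<in> carrier_mat n n" "B \<in> carrier_mat n n"
    and "\<And>i j. i < n \<Longrightarrow> j < n \<Longrightarrow> (\<lambda>k. A k $$ (i, j)) \<longlonglongrightarrow> B $$ (i, j)"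
  shows "(\<lambda>k. det (A k)) \<longlonglongrightarrow> det B"
  unfolding det_def'[OF assms(1)] det_def'[OF assms(2)]
  by (intro tendsto_sum tendsto_mult tendsto_const tendsto_prod assms(3)) (auto dest: permutes_in_image)

text \<open>Convergence is stated for values at a point, so no topology on polynomials is required;
  the values are determinants.\<close>

lemma tendsto_char_poly:
  fixes A :: "nat \<Rightarrow> real mat"
  assumes "\<And>k. A k \<in> carrier_mat n n" "B \<in> carrier_mat n n"
    and "\<And>i j. i < n \<Longrightarrow> j < n \<Longrightarrow> (\<lambda>k. A k $$ (i, j)) \<longlonglongrightarrow> B $$ (i, j)"
  shows "(\<lambda>k. poly (char_poly (A k)) x) \<longlonglongrightarrow> poly (char_poly B) x"
  unfolding char_poly_matrix[OF assms(1)] char_poly_matrix[OF assms(2)]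
proof (rule tendsto_det[of _ n])
  fix i j assume ij: "i < n" "j < n"
  have [simp]: "dim_row (A k) = n" "dim_col (A k) = n" for k using assms(1)[of k] by auto
  show "(\<lambda>k. (- char_matrix (A k) x) $$ (i, j)) \<longlonglongrightarrow> (- char_matrix B x) $$ (i, j)"
    using ij assms(2) by (auto simp: char_matrix_def intro!: tendsto_intros assms(3))
qed (use assms in auto)

text \<open>Realizability over the reals: \<open>P\<close> will be the characteristic polynomial of
  a real matrix with spectrum \<open>ls\<close>. The polynomial identity replaces the conditions on
  the spectrum and the Perron eigenvalue, and it passes to limits.\<close>

definition attainable :: "nat \<Rightarrow> real poly \<Rightarrow> real \<Rightarrow> bool" where
  "attainable n P r \<longleftrightarrow>
     (\<exists>A\<in>carrier_mat n n. nonnegative_mat A \<and> line_sums A r \<and> char_poly A = [:- r, 1:] * P)"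

text \<open>An entry of a nonnegative matrix is at most its row sum, and a convergent sequence of
  sums is bounded; so the witnesses have an entrywise convergent subsequence.\<close>

lemma attainable_closed:
  assumes att: "\<And>k. attainable n P (r k)" and lim: "r \<longlonglongrightarrow> l"
  shows "attainable n P l"
proof -
  obtain A where A: "\<And>k. A k \<in> carrier_mat n n" "\<And>k. nonnegative_mat (A k)"
      "\<And>k. line_sums (A k) (r k)" "\<And>k. char_poly (A k) = [:- r k, 1:] * P"
    using att unfolding attainable_def by metis
  have [simp]: "dim_row (A k) = n" "dim_col (A k) = n" for k using A(1)[of k] by auto
  obtain K where K: "\<And>k. \<bar>r k\<bar> \<le> K"
    using convergent_imp_Bseq[OF convergentI[OF lim]] by (auto simp: Bseq_def)
  have nonneg: "0 \<le> A k $$ (i, j)" if "i < n" "j < n" for k i j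
    using A(2)[of k] that by (auto simp: nonnegative_mat_def)
  have "\<bar>A k $$ p\<bar> \<le> K" if p: "p \<in> {..<n} \<times> {..<n}" for k p
  proof -
    obtain i j where ij: "p = (i, j)" "i < n" "j < n" using p by auto
    have "A k $$ (i, j) \<le> (\<Sum>j<n. A k $$ (i, j))"
      using ij nonneg by (intro member_le_sum) auto
    also have "\<dots> = r k" using A(3)[of k] ij by (simp add: line_sums_def)
    finally show ?thesis using K[of k] nonneg[of i j k] ij by simp
  qed
  then obtain \<phi> where \<phi>: "strict_mono \<phi>"
      "\<And>p. p \<in> {..<n} \<times> {..<n} \<Longrightarrow> convergent (\<lambda>k. A (\<phi> k) $$ p)"
    using finite_family_convergent_subseq[of "{..<n} \<times> {..<n}" "\<lambda>k p. A k $$ p" K] by auto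
  define B where "B = mat n n (\<lambda>p. lim (\<lambda>k. A (\<phi> k) $$ p))"
  have B: "B \<in> carrier_mat n n" by (simp add: B_def)
  have AB: "(\<lambda>k. A (\<phi> k) $$ (i, j)) \<longlonglongrightarrow> B $$ (i, j)" if "i < n" "j < n" for i j
    using \<phi>(2)[of "(i, j)"] that by (simp add: B_def convergent_LIMSEQ_iff)
  have r\<phi>: "(\<lambda>k. r (\<phi> k)) \<longlonglongrightarrow> l" using LIMSEQ_subseq_LIMSEQ[OF lim \<phi>(1)] by (simp add: o_def)
  have "nonnegative_mat B"
    using B nonneg by (auto simp: nonnegative_mat_def intro!: LIMSEQ_le_const[OF AB])
  moreover have "line_sums B l"
  proof -
    have "(\<Sum>j<n. B $$ (i, j)) = l" if "i < n" for i
    proof (rule LIMSEQ_unique)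
      show "(\<lambda>k. \<Sum>j<n. A (\<phi> k) $$ (i, j)) \<longlonglongrightarrow> (\<Sum>j<n. B $$ (i, j))"
        using that by (intro tendsto_sum AB) auto
      show "(\<lambda>k. \<Sum>j<n. A (\<phi> k) $$ (i, j)) \<longlonglongrightarrow> l"
        using r\<phi> A(3) that by (simp add: line_sums_def)
    qed
    moreover have "(\<Sum>i<n. B $$ (i, j)) = l" if "j < n" for j
    proof (rule LIMSEQ_unique)
      show "(\<lambda>k. \<Sum>i<n. A (\<phi> k) $$ (i, j)) \<longlonglongrightarrow> (\<Sum>i<n. B $$ (i, j))"
        using that by (intro tendsto_sum AB) auto
      show "(\<lambda>k. \<Sum>i<n. A (\<phi> k) $$ (i, j)) \<longlonglongrightarrow> l"
        using r\<phi> A(3) that by (simp add: line_sums_def)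
    qed
    ultimately show ?thesis using B by (simp add: line_sums_def)
  qed
  \<comment> \<open>Equality of values at every real \<open>x\<close> is enough, since a real
    polynomial is determined by them.\<close>
  moreover have "poly (char_poly B) x = poly ([:- l, 1:] * P) x" for x
  proof (rule LIMSEQ_unique)
    show "(\<lambda>k. poly (char_poly (A (\<phi> k))) x) \<longlonglongrightarrow> poly (char_poly B) x"
      by (rule tendsto_char_poly[OF A(1) B AB])
    show "(\<lambda>k. poly (char_poly (A (\<phi> k))) x) \<longlonglongrightarrow> poly ([:- l, 1:] * P) x"
      unfolding A(4) poly_mult using r\<phi> by (auto intro!: tendsto_intros)
  qed
  then have "char_poly B = [:- l, 1:] * P" by (simp only: poly_eq_poly_eq_iff[symmetric] fun_eq_iff simp_thms)
  ultimately show ?thesis using B unfolding attainable_def by blast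
qed

section \<open>The Perron eigenvalue and the reduction to \<open>attainable\<close>\<close>

text \<open>Read the eigenvector equation at a coordinate of largest modulus \<open>N\<close>: its
  right-hand side has modulus at most \<open>r * N\<close>.\<close>

lemma eigenvalue_le_line_sum:
  assumes A: "A \<in> carrier_mat n n" "nonnegative_mat A" "line_sums A r"
    and ev: "eigenvalue (map_mat complex_of_real A) \<mu>"
  shows "cmod \<mu> \<le> r"
proof -
  obtain v where v: "v \<in> carrier_vec n" "v \<noteq> 0\<^sub>v n" "map_mat complex_of_real A *\<^sub>v v = \<mu> \<cdot>\<^sub>v v"
    using ev A(1) by (auto simp: eigenvalue_def eigenvector_def)
  define N where "N = Max ((\<lambda>i. cmod (v $ i)) ` {..<n})"
  have "n \<noteq> 0" using v by auto
  then have fin: "finite ((\<lambda>i. cmod (v $ i)) ` {..<n})" "(\<lambda>i. cmod (v $ i)) ` {..<n} \<noteq> {}" by auto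
  obtain i where i: "i < n" "N = cmod (v $ i)" using Max_in[OF fin] by (auto simp: N_def)
  have le: "cmod (v $ j) \<le> N" if "j < n" for j
    unfolding N_def using that by (intro Max_ge) auto
  obtain j where "j < n" "v $ j \<noteq> 0" using v by (metis carrier_vecD eq_vecI index_zero_vec)
  then have "N > 0" using le[of j] by (meson less_le_trans zero_less_norm_iff)
  have "\<mu> * v $ i = (\<Sum>j<n. complex_of_real (A $$ (i, j)) * v $ j)"
    using arg_cong[OF v(3), of "\<lambda>u. u $ i"] A(1) v(1) i
    by (simp add: scalar_prod_def lessThan_atLeast0)
  then have "cmod \<mu> * N = cmod (\<Sum>j<n. complex_of_real (A $$ (i, j)) * v $ j)"
    using i by (metis norm_mult)
  also have "\<dots> \<le> (\<Sum>j<n. A $$ (i, j) * N)"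
    using A i le by (intro sum_norm_le) (auto simp: norm_mult nonnegative_mat_def intro!: mult_left_mono)
  also have "\<dots> = r * N" using A i by (simp add: sum_distrib_right[symmetric] line_sums_def)
  finally show ?thesis using \<open>N > 0\<close> by simp
qed

text \<open>A monic complex polynomial is the product of its linear factors, and the embedding of
  the reals is injective on coefficients.\<close>

lemma real_poly_eqI_proots:
  fixes p q :: "real poly"
  assumes "monic p" "monic q"
    and "proots (map_poly complex_of_real p) = proots (map_poly complex_of_real q)"
  shows "p = q"
proof -
  have "map_poly complex_of_real p = (\<Prod>x\<in>#proots (map_poly complex_of_real p). [:- x, 1:])"
    if "monic p" for p
    using complex_poly_decompose_multiset[of "map_poly complex_of_real p"] that by simp
  then have "map_poly complex_of_real p = map_poly complex_of_real q" using assms by metis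
  then show ?thesis by (simp add: poly_eq_iff)
qed

context reflection
begin

text \<open>The line sum \<open>r\<close> is an eigenvalue and bounds the modulus of all others, so
  it is the Perron eigenvalue \<open>l1\<close>. The other eigenvalues, with multiplicity, then
  determine the real cofactor.\<close>

lemma realizable_iff_attainable:
  assumes B: "B \<in> carrier_mat m m" and ls: "proots (map_poly complex_of_real (char_poly B)) = mset ls"
  shows "(\<exists>A\<in>carrier_mat (Suc m) (Suc m). generalized_doubly_stochastic A \<and> realizable_by l1 ls A) \<longleftrightarrow>
    (\<exists>r. l1 = complex_of_real r \<and> attainable (Suc m) (char_poly B) r)"
proof -
  have ev: "eigenvalue (map_mat complex_of_real A) x \<longleftrightarrow> poly (map_poly of_real (char_poly A)) x = 0"
    if "A \<in> carrier_mat k k" for A x k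
    using eigenvalue_root_char_poly[of "map_mat complex_of_real A" k x] that
    by (simp add: of_real_hom.char_poly_hom[OF that])
  have spec: "spectrum_mset A = proots (map_poly of_real (char_poly A))"
    if "A \<in> carrier_mat k k" for A k
    by (simp add: spectrum_mset_def of_real_hom.char_poly_hom[OF that])
  have mp: "map_poly complex_of_real ([:- r, 1:] * p) = [:- of_real r, 1:] * map_poly of_real p" for r p
    by (simp only: map_poly_of_real_mult) (simp add: map_poly_pCons)
  have nz: "map_poly complex_of_real (char_poly D) \<noteq> 0" if "D \<in> carrier_mat k k" for D k
    using degree_monic_char_poly[OF that] by auto
  have pr: "proots (map_poly complex_of_real ([:- r, 1:] * char_poly D)) =
      add_mset (of_real r) (proots (map_poly of_real (char_poly D)))" if "D \<in> carrier_mat k k" for r D k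
    unfolding mp using nz[OF that] by (subst proots_mult) auto
  show ?thesis
  proof safe
    fix A assume A: "A \<in> carrier_mat (Suc m) (Suc m)" and "generalized_doubly_stochastic A"
      and rz: "realizable_by l1 ls A"
    then obtain r where r: "0 \<le> r" "line_sums A r"
      by (auto simp: generalized_doubly_stochastic_def line_sums_def)
    define D where "D = mat m m (\<lambda>(i, j). (Q * A * Q) $$ (Suc i, Suc j))"
    have D: "D \<in> carrier_mat m m" by (simp add: D_def)
    have cp: "char_poly A = [:- r, 1:] * char_poly D"
      using char_poly_line_sums[OF A r(2)] by (simp add: D_def)
    have nn: "nonnegative_mat A" and perron: "is_perron_eigenvalue A l1"
      and sp: "spectrum_mset A = mset (l1 # ls)" using rz by (auto simp: realizable_by_def)
    have "eigenvalue (map_mat complex_of_real A) (of_real r)"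
      unfolding ev[OF A] cp mp by simp
    then have "r \<le> cmod l1" using perron r(1) unfolding is_perron_eigenvalue_def
      by (metis abs_of_nonneg norm_of_real)
    moreover have "cmod l1 \<le> r"
      using perron eigenvalue_le_line_sum[OF A nn r(2)] by (simp add: is_perron_eigenvalue_def)
    moreover have "l1 = of_real (cmod l1)"
      using perron unfolding is_perron_eigenvalue_def by (auto elim!: nonneg_Reals_cases)
    ultimately have l1: "l1 = of_real r" by simp
    \<comment> \<open>One copy of \<open>r\<close> is removed from both multisets; further copies
      may remain in \<open>ls\<close>.\<close>
    have "proots (map_poly complex_of_real (char_poly D)) = mset ls"
      using sp unfolding spec[OF A] cp pr[OF D] l1 by simp
    then have "char_poly D = char_poly B"
      using degree_monic_char_poly[OF B] degree_monic_char_poly[OF D] ls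
      by (intro real_poly_eqI_proots) auto
    then show "\<exists>r. l1 = complex_of_real r \<and> attainable (Suc m) (char_poly B) r"
      using l1 A nn r cp unfolding attainable_def by auto
  next
    fix r assume "attainable (Suc m) (char_poly B) r"
    then obtain A where A: "A \<in> carrier_mat (Suc m) (Suc m)" "nonnegative_mat A" "line_sums A r"
      "char_poly A = [:- r, 1:] * char_poly B" unfolding attainable_def by blast
    have evr: "eigenvalue (map_mat complex_of_real A) (of_real r)"
      unfolding ev[OF A(1)] A(4) mp by simp
    \<comment> \<open>\<open>attainable\<close> puts no sign on \<open>r\<close>; the sign follows
      because \<open>r\<close> bounds a modulus.\<close>
    have "0 \<le> r" using eigenvalue_le_line_sum[OF A(1-3) evr] by (meson norm_ge_zero order_trans)
    then have "is_perron_eigenvalue A (of_real r)"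
      using evr eigenvalue_le_line_sum[OF A(1-3)] by (auto simp: is_perron_eigenvalue_def)
    moreover have "spectrum_mset A = mset (of_real r # ls)"
      unfolding spec[OF A(1)] A(4) pr[OF B] ls by simp
    moreover have "generalized_doubly_stochastic A"
      using A \<open>0 \<le> r\<close> by (auto simp: generalized_doubly_stochastic_def line_sums_def)
    ultimately show "\<exists>A\<in>carrier_mat (Suc m) (Suc m). generalized_doubly_stochastic A \<and>
        realizable_by (complex_of_real r) ls A"
      using A by (auto simp: realizable_by_def)
  qed
qed

section \<open>Upward closure and the upper bound\<close>

lemma attainable_add:
  assumes "attainable (Suc m) P r" "0 \<le> s"
  shows "attainable (Suc m) P (r + real (Suc m) * s)"
proof -
  obtain A where A: "A \<in> carrier_mat (Suc m) (Suc m)" "nonnegative_mat A" "line_sums A r"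
    "char_poly A = [:- r, 1:] * P" using assms unfolding attainable_def by blast
  show ?thesis
    unfolding attainable_def
    using char_poly_shift[OF A(1,3,4), of s] A(1,2) assms(2)
    by (intro bexI[of _ "mat (Suc m) (Suc m) (\<lambda>(i, j). A $$ (i, j) + s)"]) (auto simp: nonnegative_mat_def)
qed

lemma attainable_mono:
  assumes "attainable (Suc m) P r" "r \<le> r'"
  shows "attainable (Suc m) P r'"
  using attainable_add[OF assms(1), of "(r' - r) / real (Suc m)"] assms(2) by (simp del: of_nat_Suc)

text \<open>Adding \<open>M\<close> to every entry of a matrix with line sums 0 and entries at least
  \<open>- M\<close> makes it nonnegative and raises the line sums to
  \<open>Suc m * M\<close>.\<close>

lemma attainable_norm_bound:
  assumes B: "B \<in> carrier_mat m m" "norm_bounded M B" and M: "0 \<le> M"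
  shows "attainable (Suc m) (char_poly B) (real (Suc m) * M)"
proof -
  obtain A where A: "A \<in> carrier_mat (Suc m) (Suc m)" "line_sums A 0" "char_poly A = [:- 0, 1:] * char_poly B"
    "\<And>i j. i < Suc m \<Longrightarrow> j < Suc m \<Longrightarrow> \<bar>A $$ (i, j)\<bar> \<le> M"
    using zero_line_sums_matrix[OF B M] by auto
  have "0 \<le> A $$ (i, j) + M" if "i < Suc m" "j < Suc m" for i j using A(4)[OF that] by linarith
  then show ?thesis
    unfolding attainable_def
    using char_poly_shift[OF A(1-3), of M]
    by (intro bexI[of _ "mat (Suc m) (Suc m) (\<lambda>(i, j). A $$ (i, j) + M)"]) (auto simp: nonnegative_mat_def)
qed

end

section \<open>The least threshold\<close>

theorem theorem4p3:
  fixes n :: nat and ls :: "complex list" and w :: real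
  assumes "n \<ge> 2"
    and "length ls = n - 1"
    and "image_mset cnj (mset ls) = mset ls"
    and "(\<forall>z\<in>set ls. z \<in> \<real>) \<or> (\<forall>z\<in>set ls. Re z = 0)"
    and "w = Min (\<Union>z\<in>set ls. {Re z, - Re z, Im z, - Im z})"
  shows "\<exists>l0::real.
           Max (cmod ` set ls) \<le> l0 \<and> l0 \<le> real n * \<bar>w\<bar> \<and>
           realizability_threshold n ls l0 \<and>
           (\<forall>l. realizability_threshold n ls l \<longrightarrow> l0 \<le> l)"
proof -
  obtain m where n: "n = Suc m" and m: "length ls = m" and ne: "ls \<noteq> []"
    using assms(1,2) by (cases n; cases ls) auto
  obtain Q where "reflection m Q"
    using ex_orthogonal_symmetric_first_column[of n] by (auto simp: reflection_def n)
  then interpret reflection m Q .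
  \<comment> \<open>The minimum ranges over a set closed under negation, so \<open>- w\<close>
    bounds all real and imaginary parts in absolute value. One of the two parts of \<open>z\<close>
    is zero, so \<open>cmod z\<close> is the absolute value of the other.\<close>
  have cmod_le: "cmod z \<le> \<bar>w\<bar>" if z: "z \<in> set ls" for z
  proof -
    have w_le: "w \<le> x" if "x \<in> {Re z, - Re z, Im z, - Im z}" for x
      unfolding assms(5) using z that by (intro Min_le) auto
    have "\<bar>Re z\<bar> \<le> \<bar>w\<bar>" "\<bar>Im z\<bar> \<le> \<bar>w\<bar>"
      using w_le[of "Re z"] w_le[of "- Re z"] w_le[of "Im z"] w_le[of "- Im z"]
      by (simp_all add: abs_le_iff)
    moreover have "Im z = 0 \<or> Re z = 0" using assms(4) z by (auto simp: complex_is_Real_iff)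
    ultimately show ?thesis by (auto simp: cmod_def)
  qed
  obtain B where B: "B \<in> carrier_mat m m" "proots (map_poly complex_of_real (char_poly B)) = mset ls"
    "norm_bounded \<bar>w\<bar> B"
    using real_matrix_with_spectrum[OF assms(3), of "\<bar>w\<bar>"] cmod_le m by auto
  define F where "F = {r. attainable n (char_poly B) r}"
  \<comment> \<open>A threshold is thus unique when it exists, which settles the minimality claim at
    the end.\<close>
  have thr: "realizability_threshold n ls l \<longleftrightarrow> F = {l..}" for l
  proof -
    have "realizability_threshold n ls l \<longleftrightarrow>
        (\<forall>l1::complex. (\<exists>r. l1 = of_real r \<and> r \<in> F) \<longleftrightarrow> l1 \<in> \<real> \<and> l \<le> Re l1)"
      unfolding realizability_threshold_def n realizable_iff_attainable[OF B(1,2)] F_def mem_Collect_eq ..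
    also have "\<dots> \<longleftrightarrow> (\<forall>r. r \<in> F \<longleftrightarrow> l \<le> r)"
      (is "?L \<longleftrightarrow> ?R")
    proof
      assume L: ?L
      show ?R
      proof
        fix r show "r \<in> F \<longleftrightarrow> l \<le> r" using L[rule_format, of "of_real r"] by simp
      qed
    next
      assume ?R
      then have R: "r \<in> F \<longleftrightarrow> l \<le> r" for r by blast
      show ?L
      proof
        fix l1 :: complex
        have "(\<exists>r. l1 = of_real r \<and> r \<in> F) \<longleftrightarrow> l1 \<in> \<real> \<and> Re l1 \<in> F"
          by (auto elim!: Reals_cases)
        then show "(\<exists>r. l1 = of_real r \<and> r \<in> F) \<longleftrightarrow> l1 \<in> \<real> \<and> l \<le> Re l1"
          by (simp only: R)
      qed
    qed
    finally show ?thesis by (simp only: set_eq_iff atLeast_iff)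
  qed
  have nw: "real n * \<bar>w\<bar> \<in> F" using attainable_norm_bound[OF B(1,3)] by (simp add: F_def n)
  \<comment> \<open>An attainable \<open>r\<close> is a Perron eigenvalue of a matrix having each
    entry of \<open>ls\<close> as an eigenvalue. The bound also makes \<open>Inf F\<close>
    meaningful.\<close>
  have lb: "Max (cmod ` set ls) \<le> r" if "r \<in> F" for r
  proof -
    have "\<exists>r'. complex_of_real r = of_real r' \<and> attainable (Suc m) (char_poly B) r'"
      using that by (auto simp: F_def n)
    then obtain A where A: "A \<in> carrier_mat n n" "realizable_by (of_real r) ls A"
      unfolding realizable_iff_attainable[OF B(1,2), symmetric] n by blast
    have cA: "map_mat complex_of_real A \<in> carrier_mat n n" using A(1) by simp
    have "0 \<le> r" using A(2) by (simp add: realizable_by_def is_perron_eigenvalue_def)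
    have "cmod z \<le> r" if z: "z \<in> set ls" for z
    proof -
      have "z \<in># spectrum_mset A" using A(2) z by (simp add: realizable_by_def)
      then have "eigenvalue (map_mat complex_of_real A) z"
        using degree_monic_char_poly[OF cA] unfolding eigenvalue_root_char_poly[OF cA] spectrum_mset_def
        by (subst (asm) set_count_proots) auto
      then have "cmod z \<le> cmod (of_real r)"
        using A(2) unfolding realizable_by_def is_perron_eigenvalue_def by blast
      then show ?thesis using \<open>0 \<le> r\<close> by simp
    qed
    then show ?thesis using ne by simp
  qed
  then have bdd: "bdd_below F" by (rule bdd_belowI)
  have "Inf F \<in> F"
  proof -
    \<comment> \<open>These elements form a sequence in \<open>F\<close> converging to
      \<open>Inf F\<close>, to which \<open>attainable_closed\<close> applies.\<close>
    have "\<exists>r\<in>F. r < Inf F + 1 / real (Suc k)" for k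
      using nw by (intro cInf_lessD) auto
    then have "\<exists>r. \<forall>k. r k \<in> F \<and> r k < Inf F + 1 / real (Suc k)"
      by (intro choice allI) blast
    then obtain r where r: "\<And>k. r k \<in> F" "\<And>k. r k < Inf F + 1 / real (Suc k)" by blast
    have "r \<longlonglongrightarrow> Inf F"
    proof (rule tendsto_sandwich[OF _ _ tendsto_const])
      show "(\<lambda>k. Inf F + 1 / real (Suc k)) \<longlonglongrightarrow> Inf F"
        using tendsto_add[OF tendsto_const LIMSEQ_inverse_real_of_nat] by (simp add: inverse_eq_divide)
    qed (use r cInf_lower[OF _ bdd] in \<open>auto intro!: always_eventually less_imp_le\<close>)
    then show ?thesis using attainable_closed[of n "char_poly B" r] r(1) by (simp add: F_def)
  qed
  have "F = {Inf F..}"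
  proof (intro equalityI subsetI)
    fix r assume "r \<in> {Inf F..}"
    then show "r \<in> F"
      using attainable_mono[of "char_poly B" "Inf F" r] \<open>Inf F \<in> F\<close> by (simp add: F_def n)
  qed (simp add: cInf_lower[OF _ bdd])
  then have "realizability_threshold n ls (Inf F)" by (rule iffD2[OF thr])
  moreover have "Inf F \<le> l" if "realizability_threshold n ls l" for l
    using that unfolding thr by simp
  ultimately show ?thesis using lb[OF \<open>Inf F \<in> F\<close>] cInf_lower[OF nw bdd] by blast
qed

end
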